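(* Let $d\ge1$ be an integer and let $\Omega\subseteq\mathbb{R}^d$ be a locally compact set. The graph of a typical function $f\in C(\Omega)$ is microscopic in $\mathbb{R}^{d+1}$.
   Context: $C(\Omega)$ is the space of continuous real functions on $\Omega$ with the compact-open topology. A property holds for a typical $f$ if there is a comeager set $\mathcal{F}\subseteq C(\Omega)$ such that every $f\in\mathcal{F}$ has the property. A box in $\mathbb{R}^m$ is a cartesian product of $m$ compact intervals in $\mathbb{R}$; $\lambda_m$ is Lebesgue measure in $\mathbb{R}^m$. A set $X\subseteq\mathbb{R}^m$ is microscopic in $\mathbb{R}^m$ if for each $\varepsilon>0$ there is a sequence of boxes $B_1,B_2,\dots$ in $\mathbb{R}^m$ covering $X$ such that $\lambda_m(B_n)\le\varepsilon^n$ for all $n\ge1$. *)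

theory Defs
  imports "HOL-Analysis.Analysis"
begin

definition nowhere_dense_in :: "'a topology \<Rightarrow> 'a set \<Rightarrow> bool" where
  "nowhere_dense_in X N \<longleftrightarrow> N \<subseteq> topspace X \<and> X interior_of (X closure_of N) = {}"

definition meager_in :: "'a topology \<Rightarrow> 'a set \<Rightarrow> bool" where
  "meager_in X A \<longleftrightarrow>
     (\<exists>N :: nat \<Rightarrow> 'a set. (\<forall>n. nowhere_dense_in X (N n)) \<and> A = (\<Union>n. N n))"

definition comeager_in :: "'a topology \<Rightarrow> 'a set \<Rightarrow> bool" where
  "comeager_in X A \<longleftrightarrow> A \<subseteq> topspace X \<and> meager_in X (topspace X - A)"

definition typically :: "'a topology \<Rightarrow> ('a \<Rightarrow> bool) \<Rightarrow> bool" where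
  "typically X P \<longleftrightarrow> (\<exists>F. comeager_in X F \<and> (\<forall>f\<in>F. P f))"

text \<open>A function on \<open>\<Omega>\<close> is represented by its extensional version (constantly
  \<open>undefined\<close> outside \<open>\<Omega>\<close>), so that equality of representatives is equality on \<open>\<Omega>\<close>.\<close>

definition C_space :: "'a::topological_space set \<Rightarrow> ('a \<Rightarrow> real) set" where
  "C_space \<Omega> = {f \<in> extensional \<Omega>. continuous_on \<Omega> f}"

text \<open>The choice \<open>K = {}\<close> makes the whole of \<open>C_space \<Omega>\<close> a member of the subbase, hence the
  topology has \<open>C_space \<Omega>\<close> as its underlying set.\<close>

definition compact_open_topology :: "'a::topological_space set \<Rightarrow> ('a \<Rightarrow> real) topology" where
  "compact_open_topology \<Omega> = topology_generated_by
     {{f \<in> C_space \<Omega>. f ` K \<subseteq> U} | K U. compact K \<and> K \<subseteq> \<Omega> \<and> open U}"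

lemma topspace_compact_open_topology [simp]: "topspace (compact_open_topology \<Omega>) = C_space \<Omega>"
proof -
  have "C_space \<Omega> \<in> {{f \<in> C_space \<Omega>. f ` K \<subseteq> U} | K U. compact K \<and> K \<subseteq> \<Omega> \<and> open U}"
    by (rule CollectI, rule exI[of _ "{}"], rule exI[of _ UNIV]) auto
  then show ?thesis
    unfolding compact_open_topology_def topology_generated_by_topspace by blast
qed

text \<open>Stated for an arbitrary Euclidean space with its standard orthonormal basis; the intervals
  are nonempty but may be degenerate.\<close>

definition is_compact_box :: "'a::euclidean_space set \<Rightarrow> bool" where
  "is_compact_box B \<longleftrightarrow> (\<exists>a b. (\<forall>i\<in>Basis. a \<bullet> i \<le> b \<bullet> i) \<and> B = cbox a b)"

definition microscopic :: "'a::euclidean_space set \<Rightarrow> bool" where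
  "microscopic X \<longleftrightarrow>
     (\<forall>\<epsilon>::real. \<epsilon> > 0 \<longrightarrow>
       (\<exists>B :: nat \<Rightarrow> 'a set.
          (\<forall>n\<ge>1. is_compact_box (B n) \<and> measure lebesgue (B n) \<le> \<epsilon> ^ n) \<and>
          X \<subseteq> (\<Union>n\<in>{1..}. B n)))"

text \<open>The space \<open>\<real>\<^sup>d\<^sup>+\<^sup>1\<close> is rendered as the Euclidean space \<open>\<real>\<^sup>d \<times> \<real>\<close>: its basis is the union of
  the two bases, so its boxes are the products of \<open>d + 1\<close> intervals and \<open>lebesgue\<close> on it is
  \<open>(d + 1)\<close>-dimensional Lebesgue measure.\<close>

definition graph_on :: "'a set \<Rightarrow> ('a \<Rightarrow> 'b) \<Rightarrow> ('a \<times> 'b) set" where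
  "graph_on \<Omega> f = {(x, f x) | x. x \<in> \<Omega>}"

end

(* Exhaust \<Omega> by compact sets K n. The functions whose graph over K n is covered by the interiors of
   boxes of measure at most (1 / (n + 1)) ^ m, m = 1, 2, ..., form an open set U n, by compactness.
   It is dense: replace a (Tietze extended) function G by G o \<phi>, where \<phi> rounds every coordinate
   to a finite grid, except for coordinates within \<eta> of finitely many values, where it
   interpolates. On a bounded set the graph of G o \<phi> then lies in N plates of thickness 2 \<eta>,
   orthogonal to the coordinate axes, and N depends on the grid but not on \<eta>; so choose \<eta> with
   regard to N. *)

theory Submission
  imports Defs
begin

section \<open>Microscopic sets and covers by interiors of boxes\<close>

lemma microscopic_UN:
  fixes X :: "nat \<Rightarrow> 'a::euclidean_space set"
  assumes "\<And>j. microscopic (X j)"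
  shows "microscopic (\<Union>j. X j)"
  unfolding microscopic_def
proof (intro allI impI)
  fix \<epsilon> :: real
  assume "\<epsilon> > 0"
  define \<delta> where "\<delta> = min \<epsilon> 1"
  have \<delta>: "0 < \<delta>" "\<delta> \<le> 1" "\<delta> \<le> \<epsilon>"
    using \<open>\<epsilon> > 0\<close> by (auto simp: \<delta>_def)
  \<comment> \<open>The exponent \<open>2 ^ Suc j\<close> pays for the renumbering below, where box
    \<open>n\<close> of \<open>X j\<close> gets a number less than \<open>2 ^ Suc j * n\<close>. As
    \<open>\<delta> \<le> 1\<close>, its measure then fits the bound for that number.\<close>
  have "\<exists>B. \<forall>j. (\<forall>n\<ge>1. is_compact_box (B j n) \<and>
          measure lebesgue (B j n) \<le> (\<delta> ^ (2 ^ Suc j)) ^ n) \<and> X j \<subseteq> (\<Union>n\<in>{1..}. B j n)"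
    using assms \<delta> unfolding microscopic_def by (intro choice allI) simp
  then obtain B where
    box: "\<And>j n. n \<ge> 1 \<Longrightarrow> is_compact_box (B j n)" and
    meas: "\<And>j n. n \<ge> 1 \<Longrightarrow> measure lebesgue (B j n) \<le> (\<delta> ^ (2 ^ Suc j)) ^ n" and
    cover: "\<And>j. X j \<subseteq> (\<Union>n\<in>{1..}. B j n)"
    by blast
  \<comment> \<open>Box \<open>n\<close> of \<open>X j\<close> gets the number \<open>2 ^ j * (2 * n - 1)\<close>, which is linear in \<open>n\<close> for fixed \<open>j\<close>.\<close>
  define r :: "nat \<Rightarrow> nat" where "r m = (m div 2 ^ multiplicity 2 m + 1) div 2" for m
  define C where "C m = B (multiplicity 2 m) (r m)" for m :: nat
  have r: "r m \<ge> 1" "m \<le> 2 ^ Suc (multiplicity 2 m) * r m" if "m \<ge> 1" for m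
  proof -
    obtain q where q: "m = 2 ^ multiplicity 2 m * q"
      by (meson dvdE multiplicity_dvd)
    then have *: "r m = (q + 1) div 2"
      unfolding r_def by (metis nonzero_mult_div_cancel_left power_not_zero zero_neq_numeral)
    have "q \<ge> 1"
      using q that by (cases q) auto
    then show "r m \<ge> 1"
      using * by simp
    have "q \<le> 2 * r m"
      using * by linarith
    then have "2 ^ multiplicity 2 m * q \<le> 2 ^ multiplicity 2 m * (2 * r m)"
      by simp
    then show "m \<le> 2 ^ Suc (multiplicity 2 m) * r m"
      using q by (simp add: mult.assoc mult.left_commute)
  qed
  have "is_compact_box (C m) \<and> measure lebesgue (C m) \<le> \<epsilon> ^ m" if "m \<ge> 1" for m
  proof -
    have "measure lebesgue (C m) \<le> \<delta> ^ (2 ^ Suc (multiplicity 2 m) * r m)"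
      using meas[OF r(1)[OF that], of "multiplicity 2 m"] by (simp add: C_def power_mult)
    also have "\<dots> \<le> \<delta> ^ m"
      using \<delta> r(2)[OF that] by (intro power_decreasing) auto
    also have "\<dots> \<le> \<epsilon> ^ m"
      using \<delta> by (intro power_mono) auto
    finally show ?thesis
      using box[OF r(1)[OF that]] by (simp add: C_def)
  qed
  moreover have "(\<Union>j. X j) \<subseteq> (\<Union>m\<in>{1..}. C m)"
  proof
    fix x assume "x \<in> (\<Union>j. X j)"
    then obtain j n where n: "n \<ge> 1" "x \<in> B j n"
      using cover by fastforce
    define m where "m = 2 ^ j * (2 * n - 1)"
    have odd: "\<not> 2 dvd 2 * n - 1"
      using n(1) by simp
    have "multiplicity 2 m = j"
    proof (rule multiplicity_eqI)
      show "2 ^ j dvd m"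
        by (simp add: m_def)
      show "\<not> 2 ^ Suc j dvd m"
        using odd unfolding m_def by (simp add: mult.commute[of 2])
    qed
    moreover from this have "r m = n"
      using n(1) by (simp add: r_def m_def)
    moreover have "m \<ge> 1"
      using n(1) by (simp add: m_def)
    ultimately show "x \<in> (\<Union>m\<in>{1..}. C m)"
      using n by (auto simp: C_def intro!: bexI[of _ m])
  qed
  ultimately show "\<exists>B. (\<forall>n\<ge>1. is_compact_box (B n) \<and> measure lebesgue (B n) \<le> \<epsilon> ^ n) \<and>
      (\<Union>j. X j) \<subseteq> (\<Union>n\<in>{1..}. B n)"
    by blast
qed

text \<open>Interiors instead of the boxes themselves make the condition stable under small
  perturbations of a compact set. The tolerance is fixed here; microscopic sets reappear when it is
  let tend to 0.\<close>

definition small_open_cover :: "real \<Rightarrow> 'a::euclidean_space set \<Rightarrow> bool" where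
  "small_open_cover \<epsilon> X \<longleftrightarrow>
     (\<exists>B :: nat \<Rightarrow> 'a set.
        (\<forall>n\<ge>1. is_compact_box (B n) \<and> measure lebesgue (B n) \<le> \<epsilon> ^ n) \<and>
        X \<subseteq> (\<Union>n\<in>{1..}. interior (B n)))"

lemma small_open_cover_subset: "small_open_cover \<epsilon> Y \<Longrightarrow> X \<subseteq> Y \<Longrightarrow> small_open_cover \<epsilon> X"
  unfolding small_open_cover_def by (meson subset_trans)

text \<open>Since \<open>\<epsilon> \<le> 1\<close>, the bound \<open>\<epsilon> ^ N\<close> is the
  strictest of the first \<open>N\<close> ones, so the boxes may be numbered in any order.\<close>

lemma small_open_coverI_finite:
  fixes X :: "'a::euclidean_space set"
  assumes "0 < \<epsilon>" "\<epsilon> \<le> 1" and fin: "finite I" and "card I \<le> N"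
    and box: "\<And>i. i \<in> I \<Longrightarrow> is_compact_box (A i)"
    and meas: "\<And>i. i \<in> I \<Longrightarrow> measure lebesgue (A i) \<le> \<epsilon> ^ N"
    and cover: "X \<subseteq> (\<Union>i\<in>I. interior (A i))"
  shows "small_open_cover \<epsilon> X"
proof -
  obtain h where h: "bij_betw h {1..card I} I"
    using ex_bij_betw_nat_finite_1[OF fin] by blast
  \<comment> \<open>The sequence is continued by a single point, which has measure 0.\<close>
  define B where "B n = (if n \<le> card I then A (h n) else cbox 0 0)" for n
  have "is_compact_box (B n) \<and> measure lebesgue (B n) \<le> \<epsilon> ^ n" if "n \<ge> 1" for n
  proof (cases "n \<le> card I")
    case True
    then have "h n \<in> I"
      using h that by (auto simp: bij_betw_def)
    moreover have "\<epsilon> ^ N \<le> \<epsilon> ^ n"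
      using assms True by (intro power_decreasing) auto
    ultimately show ?thesis
      using True box[of "h n"] meas[of "h n"] by (auto simp: B_def)
  next
    case False
    then show ?thesis
      using assms(1) unfolding B_def is_compact_box_def by (auto intro!: exI[of _ 0])
  qed
  moreover have "X \<subseteq> (\<Union>n\<in>{1..}. interior (B n))"
  proof
    fix x assume "x \<in> X"
    then obtain i where i: "i \<in> I" "x \<in> interior (A i)"
      using cover by blast
    then obtain n where "n \<in> {1..card I}" "h n = i"
      using h by (metis bij_betw_imp_surj_on imageE)
    then show "x \<in> (\<Union>n\<in>{1..}. interior (B n))"
      using i by (auto simp: B_def intro!: bexI[of _ n])
  qed
  ultimately show ?thesis
    unfolding small_open_cover_def by blast
qed

text \<open>The number of plates is known before their thickness is chosen, so the thickness can be
  adapted to the strictest bound, \<open>\<epsilon> ^ card Q\<close>.\<close>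

lemma small_open_cover_plates:
  fixes Q :: "('a::euclidean_space \<times> real) set"
  assumes "0 < \<epsilon>" "\<epsilon> \<le> 1" "0 < R" "finite Q" and Q: "\<And>e v. (e, v) \<in> Q \<Longrightarrow> e \<in> Basis"
  obtains \<eta> where "\<eta> > 0"
    "\<And>X. (\<And>z i. z \<in> X \<Longrightarrow> i \<in> Basis \<Longrightarrow> \<bar>z \<bullet> i\<bar> < R) \<Longrightarrow>
         (\<And>z. z \<in> X \<Longrightarrow> \<exists>(e, v)\<in>Q. \<bar>z \<bullet> e - v\<bar> < \<eta>) \<Longrightarrow> small_open_cover \<epsilon> X"
proof
  \<comment> \<open>The cross-section of a plate is a cube of side \<open>2 * R\<close> in the
    remaining dimensions. The choice of \<open>\<eta>\<close> gives each plate the measure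
    \<open>2 * \<eta> * S = \<epsilon> ^ card Q\<close>.\<close>
  define S where "S = (2 * R) ^ (DIM('a) - 1)"
  have "S > 0"
    using assms by (simp add: S_def)
  define \<eta> where "\<eta> = \<epsilon> ^ card Q / (2 * S)"
  show "\<eta> > 0"
    using assms \<open>S > 0\<close> by (simp add: \<eta>_def)
  fix X :: "'a set"
  assume X: "\<And>z i. z \<in> X \<Longrightarrow> i \<in> Basis \<Longrightarrow> \<bar>z \<bullet> i\<bar> < R"
    and cover: "\<And>z. z \<in> X \<Longrightarrow> \<exists>(e, v)\<in>Q. \<bar>z \<bullet> e - v\<bar> < \<eta>"
  define lo hi :: "'a \<Rightarrow> real \<Rightarrow> 'a"
    where "lo e v = (\<Sum>i\<in>Basis. (if i = e then v - \<eta> else - R) *\<^sub>R i)"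
      and "hi e v = (\<Sum>i\<in>Basis. (if i = e then v + \<eta> else R) *\<^sub>R i)" for e v
  have lo_hi: "lo e v \<bullet> i = (if i = e then v - \<eta> else - R)"
    "hi e v \<bullet> i = (if i = e then v + \<eta> else R)" if "i \<in> Basis" for e v i
    using that by (simp_all add: lo_def hi_def inner_sum_left_Basis)
  show "small_open_cover \<epsilon> X"
  proof (rule small_open_coverI_finite[where I = Q and A = "\<lambda>(e, v). cbox (lo e v) (hi e v)"])
    show "card Q \<le> card Q" ..
    fix i assume i: "i \<in> Q"
    obtain e v where ev: "i = (e, v)" by (cases i)
    then have e: "e \<in> Basis"
      using i Q by blast
    have le: "\<forall>i\<in>Basis. lo e v \<bullet> i \<le> hi e v \<bullet> i"
      using \<open>\<eta> > 0\<close> \<open>R > 0\<close> by (simp add: lo_hi)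
    then show "is_compact_box (case i of (e, v) \<Rightarrow> cbox (lo e v) (hi e v))"
      unfolding ev is_compact_box_def by auto
    have "measure lebesgue (cbox (lo e v) (hi e v)) = (\<Prod>b\<in>Basis. hi e v \<bullet> b - lo e v \<bullet> b)"
      using content_cbox[OF le] by simp
    also have "\<dots> = (\<Prod>b\<in>Basis. if b = e then 2 * \<eta> else 2 * R)"
      by (intro prod.cong) (auto simp: lo_hi)
    also have "\<dots> = 2 * \<eta> * (\<Prod>b\<in>Basis - {e}. if b = e then 2 * \<eta> else 2 * R)"
      using e by (simp add: prod.remove)
    also have "(\<Prod>b\<in>Basis - {e}. if b = e then 2 * \<eta> else 2 * R) = (\<Prod>b\<in>Basis - {e}. 2 * R)"
      by (intro prod.cong) auto
    also have "\<dots> = S"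
      using e by (simp add: S_def power_mult_distrib)
    also have "2 * \<eta> * S = \<epsilon> ^ card Q"
      using \<open>S > 0\<close> by (simp add: \<eta>_def)
    finally show "measure lebesgue (case i of (e, v) \<Rightarrow> cbox (lo e v) (hi e v)) \<le> \<epsilon> ^ card Q"
      by (simp add: ev)
  next
    show "X \<subseteq> (\<Union>i\<in>Q. interior (case i of (e, v) \<Rightarrow> cbox (lo e v) (hi e v)))"
    proof
      fix z assume z: "z \<in> X"
      then obtain e v where ev: "(e, v) \<in> Q" "\<bar>z \<bullet> e - v\<bar> < \<eta>"
        using cover by blast
      have "z \<in> box (lo e v) (hi e v)"
        unfolding mem_box
      proof
        fix i :: 'a assume i: "i \<in> Basis"
        then show "lo e v \<bullet> i < z \<bullet> i \<and> z \<bullet> i < hi e v \<bullet> i"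
          using X[OF z i] ev(2) by (auto simp: lo_hi)
      qed
      then show "z \<in> (\<Union>i\<in>Q. interior (case i of (e, v) \<Rightarrow> cbox (lo e v) (hi e v)))"
        using ev(1) by (auto intro!: bexI[of _ "(e, v)"])
    qed
  qed (use assms in auto)
qed

section \<open>Continuous staircases close to the identity\<close>

text \<open>The order of the quantifiers is the point: \<open>P\<close> and \<open>Q\<close> are
  fixed before \<open>\<eta>\<close>, so the number of plates built from them does not grow as the
  plates get thinner.\<close>

lemma exists_continuous_step_function:
  fixes h r :: real
  assumes "h > 0"
  obtains P Q :: "real set" where "finite P" "finite Q"
    "\<And>\<eta>. \<eta> > 0 \<Longrightarrow> \<exists>s. continuous_on UNIV s \<and>
       (\<forall>t. \<bar>t\<bar> \<le> r \<longrightarrow> \<bar>s t - t\<bar> \<le> h \<and> (s t \<in> P \<or> (\<exists>q\<in>Q. \<bar>t - q\<bar> < \<eta>)))"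
proof -
  define n where "n = nat \<lceil>2 * r / h\<rceil>"
  have n: "2 * r \<le> real n * h"
    using real_nat_ceiling_ge[of "2 * r / h"] assms by (simp add: n_def field_simps)
  \<comment> \<open>\<open>s\<close> is a staircase with flat steps at heights \<open>P\<close>, climbing only just to the right of \<open>Q\<close>;
    only the steepness of the climbs depends on \<open>\<eta>\<close>.\<close>
  define P Q where "P = (\<lambda>k. h * real k - r) ` {..n}" and "Q = (\<lambda>k. h * real k - r) ` {..<n}"
  have "\<exists>s. continuous_on UNIV s \<and>
       (\<forall>t. \<bar>t\<bar> \<le> r \<longrightarrow> \<bar>s t - t\<bar> \<le> h \<and> (s t \<in> P \<or> (\<exists>q\<in>Q. \<bar>t - q\<bar> < \<eta>)))"
    if "\<eta> > 0" for \<eta> :: real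
  proof -
    \<comment> \<open>The width of a climb: below \<open>\<eta>\<close>, so that a climb stays close
      to its point of \<open>Q\<close>, and at most \<open>h\<close>, so that it is at least as
      steep as the identity.\<close>
    define \<theta> where "\<theta> = min h (\<eta> / 2)"
    have \<theta>: "0 < \<theta>" "\<theta> \<le> h" "\<theta> < \<eta>"
      using assms that by (auto simp: \<theta>_def)
    \<comment> \<open>\<open>c\<close> rises from 0 to 1 on the interval from 0 to
      \<open>\<theta>\<close>. In the shifted variable \<open>u = t + r\<close>, the sum
      \<open>S m\<close> has climbs of height \<open>h\<close> starting at \<open>h * k\<close> for
      \<open>k < m\<close>.\<close>
    define c where "c v = max 0 (min 1 (v / \<theta>))" for v
    define S where "S m u = (\<Sum>k<m. h * c (u - h * real k))" for m u
    have c: "0 \<le> c v" "c v \<le> 1" "v \<le> 0 \<Longrightarrow> c v = 0" "v \<ge> \<theta> \<Longrightarrow> c v = 1" for v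
      using \<theta> by (auto simp: c_def field_simps)
    have hc: "min v h \<le> h * c v" for v
    proof (cases "v \<le> 0 \<or> v \<ge> \<theta>")
      case True
      then show ?thesis
        using c[of v] assms by auto
    next
      case False
      then have "c v = v / \<theta>"
        using \<theta> by (auto simp: c_def)
      moreover have "v * \<theta> \<le> v * h"
        using False \<theta> by (intro mult_left_mono) auto
      ultimately have "v \<le> h * c v"
        using False \<theta> by (simp add: pos_le_divide_eq mult.commute)
      then show ?thesis by simp
    qed
    \<comment> \<open>Lower bound: each climb is at least as steep as the identity, by
      \<open>hc\<close>. Upper bound: climb \<open>k\<close> starts only when \<open>u\<close>
      exceeds \<open>h * k\<close>, the total height of the climbs before it. The caps
      \<open>real m * h\<close> carry the induction; for \<open>m = n\<close> the lower one is
      harmless, because \<open>u \<le> 2 * r \<le> n * h\<close>.\<close>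
    have S: "min u (real m * h) \<le> S m u \<and> S m u \<le> min (u + h) (real m * h)" if "u \<ge> 0" for u m
    proof (induction m)
      case 0
      then show ?case
        using that assms by (simp add: S_def)
    next
      case (Suc m)
      have Suc_eq: "S (Suc m) u = S m u + h * c (u - h * real m)"
        by (simp add: S_def)
      show ?case
      proof (cases "u \<le> h * real m")
        case True
        then show ?thesis
          using Suc assms c(3)[of "u - h * real m"] unfolding Suc_eq by (simp add: algebra_simps)
      next
        case False
        have "h * c (u - h * real m) \<le> h"
          using c(2)[of "u - h * real m"] assms by simp
        then show ?thesis
          using Suc False hc[of "u - h * real m"] unfolding Suc_eq
            by (auto simp: algebra_simps min_def split: if_splits)
      qed
    qed
    have vals: "(\<exists>k\<le>m. S m u = h * real k) \<or> (\<exists>k<m. \<bar>u - h * real k\<bar> < \<eta>)" for m u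
    proof (induction m)
      case 0
      then show ?case by (simp add: S_def)
    next
      case (Suc m)
      have Suc_eq: "S (Suc m) u = S m u + h * c (u - h * real m)"
        by (simp add: S_def)
      \<comment> \<open>Apart from points close to an earlier climb, climb \<open>m\<close> has not
        begun, is complete, or is under way; in the last case \<open>u\<close> is within
        \<open>\<theta> < \<eta>\<close> of its start.\<close>
      consider "\<exists>k<m. \<bar>u - h * real k\<bar> < \<eta>" | k where "k \<le> m" "S m u = h * real k" "u - h * real m \<le> 0"
        | k where "k \<le> m" "S m u = h * real k" "u - h * real m \<ge> \<theta>"
        | "\<bar>u - h * real m\<bar> < \<eta>"
        using Suc \<theta> by fastforce
      then show ?case
      proof cases
        case 1
        then show ?thesis using less_Suc_eq by blast
      next
        case 2
        then show ?thesis
          using c(3) unfolding Suc_eq by (intro disjI1 exI[of _ k]) simp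
      next
        case 3
        then show ?thesis
          using c(4) unfolding Suc_eq by (intro disjI1 exI[of _ "Suc k"]) (simp add: algebra_simps)
      next
        case 4
        then show ?thesis by blast
      qed
    qed
    define s where "s t = S n (t + r) - r" for t
    have "continuous_on UNIV s"
      unfolding s_def S_def c_def using \<theta> by (intro continuous_intros) auto
    moreover have "\<bar>s t - t\<bar> \<le> h \<and> (s t \<in> P \<or> (\<exists>q\<in>Q. \<bar>t - q\<bar> < \<eta>))" if "\<bar>t\<bar> \<le> r" for t
    proof
      show "\<bar>s t - t\<bar> \<le> h"
        using S[of "t + r" n] that n assms unfolding s_def by linarith
      show "s t \<in> P \<or> (\<exists>q\<in>Q. \<bar>t - q\<bar> < \<eta>)"
        using vals[of n "t + r"]
      proof
        assume "\<exists>k\<le>n. S n (t + r) = h * real k"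
        then show ?thesis
          unfolding s_def P_def by auto
      next
        assume "\<exists>k<n. \<bar>t + r - h * real k\<bar> < \<eta>"
        then obtain k where "k < n" "\<bar>t - (h * real k - r)\<bar> < \<eta>"
          by (auto simp: algebra_simps)
        then show ?thesis
          unfolding Q_def by blast
      qed
    qed
    ultimately show ?thesis by blast
  qed
  moreover have "finite P" "finite Q"
    by (auto simp: P_def Q_def)
  ultimately show ?thesis
    using that by blast
qed

section \<open>The compact-open topology as uniform convergence on compact sets\<close>

lemma openin_compact_open_topology_iff:
  fixes \<Omega> :: "'a::metric_space set"
  shows "openin (compact_open_topology \<Omega>) U \<longleftrightarrow> U \<subseteq> C_space \<Omega> \<and>
    (\<forall>f\<in>U. \<exists>K \<delta>. compact K \<and> K \<subseteq> \<Omega> \<and> \<delta> > 0 \<and>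
       {g \<in> C_space \<Omega>. \<forall>x\<in>K. \<bar>g x - f x\<bar> < \<delta>} \<subseteq> U)"
proof -
  let ?near = "\<lambda>f K \<delta>. {g \<in> C_space \<Omega>. \<forall>x\<in>K. \<bar>g x - f x\<bar> < \<delta>}"
  let ?P = "\<lambda>U. \<forall>f\<in>U. \<exists>K \<delta>. compact K \<and> K \<subseteq> \<Omega> \<and> \<delta> > 0 \<and> ?near f K \<delta> \<subseteq> U"
  define \<S> where "\<S> = {{f \<in> C_space \<Omega>. f ` K \<subseteq> U} | K U. compact K \<and> K \<subseteq> \<Omega> \<and> open U}"
  have "?P U" if "generate_topology_on \<S> U" for U
    using that
  proof induction
    case Empty
    then show ?case by simp
  next
    case (Int a b)
    show ?case
    proof
      fix f assume f: "f \<in> a \<inter> b"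
      obtain K \<delta> where K: "compact K" "K \<subseteq> \<Omega>" "\<delta> > 0" "?near f K \<delta> \<subseteq> a"
        using bspec[OF Int.IH(1), of f] f by blast
      obtain L \<theta> where L: "compact L" "L \<subseteq> \<Omega>" "\<theta> > 0" "?near f L \<theta> \<subseteq> b"
        using bspec[OF Int.IH(2), of f] f by blast
      have "?near f (K \<union> L) (min \<delta> \<theta>) \<subseteq> a \<inter> b"
        using K(4) L(4) by auto
      moreover have "compact (K \<union> L)" "K \<union> L \<subseteq> \<Omega>" "min \<delta> \<theta> > 0"
        using K L by auto
      ultimately show "\<exists>K \<delta>. compact K \<and> K \<subseteq> \<Omega> \<and> \<delta> > 0 \<and> ?near f K \<delta> \<subseteq> a \<inter> b"
        by (intro exI conjI)
    qed
  next
    case (UN \<U>)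
    show ?case
    proof
      fix f assume "f \<in> \<Union>\<U>"
      then obtain a where a: "a \<in> \<U>" "f \<in> a"
        by blast
      then obtain K \<delta> where K: "compact K" "K \<subseteq> \<Omega>" "\<delta> > 0" "?near f K \<delta> \<subseteq> a"
        using bspec[OF UN.IH[OF a(1)] a(2)] by blast
      have "?near f K \<delta> \<subseteq> \<Union>\<U>"
        using K(4) Union_upper[OF a(1)] by (rule subset_trans)
      with K(1-3) show "\<exists>K \<delta>. compact K \<and> K \<subseteq> \<Omega> \<and> \<delta> > 0 \<and> ?near f K \<delta> \<subseteq> \<Union>\<U>"
        by (intro exI conjI)
    qed
  next
    case (Basis s)
    then obtain K V where s: "s = {f \<in> C_space \<Omega>. f ` K \<subseteq> V}" "compact K" "K \<subseteq> \<Omega>" "open V"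
      unfolding \<S>_def by blast
    show ?case
    proof
      fix f assume "f \<in> s"
      then have f: "continuous_on K f" "f ` K \<subseteq> V"
        using s continuous_on_subset unfolding C_space_def by auto
      obtain \<delta> where \<delta>: "\<delta> > 0" "(\<Union>y\<in>f ` K. ball y \<delta>) \<subseteq> V"
        using compact_subset_open_imp_ball_epsilon_subset
          [OF compact_continuous_image[OF f(1) s(2)] s(4) f(2)] by blast
      have "?near f K \<delta> \<subseteq> s"
      proof
        fix g assume g: "g \<in> ?near f K \<delta>"
        have "g x \<in> V" if "x \<in> K" for x
        proof -
          have "g x \<in> ball (f x) \<delta>"
            using g that by (simp add: dist_real_def abs_minus_commute)
          then show ?thesis
            using \<delta>(2) that by blast
        qed
        then show "g \<in> s"
          using g s(1) by blast
      qed
      then show "\<exists>K \<delta>. compact K \<and> K \<subseteq> \<Omega> \<and> \<delta> > 0 \<and> ?near f K \<delta> \<subseteq> s"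
        using s(2,3) \<delta>(1) by (intro exI conjI)
    qed
  qed
  from this[OF openin_topology_generated_by] have forward: "?P U" if "openin (compact_open_topology \<Omega>) U"
    using that unfolding compact_open_topology_def \<S>_def[symmetric] by blast
  have backward: "openin (compact_open_topology \<Omega>) U" if U: "U \<subseteq> C_space \<Omega>" "?P U"
  proof (subst openin_subopen, intro ballI)
    fix f assume "f \<in> U"
    then have f: "f \<in> C_space \<Omega>"
      using U(1) by blast
    obtain K \<delta> where K: "compact K" "K \<subseteq> \<Omega>" "\<delta> > 0" "?near f K \<delta> \<subseteq> U"
      using bspec[OF U(2) \<open>f \<in> U\<close>] by blast
    have cont: "continuous_on K f"
      using f K(2) continuous_on_subset unfolding C_space_def by blast
    have "uniformly_continuous_on K f"
      using cont K(1) by (rule compact_uniformly_continuous)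
    from this[unfolded uniformly_continuous_on_def, rule_format, OF half_gt_zero[OF K(3)]]
    obtain d where d: "d > 0"
      "\<And>x y. x \<in> K \<Longrightarrow> y \<in> K \<Longrightarrow> dist y x < d \<Longrightarrow> dist (f y) (f x) < \<delta> / 2"
      by blast
    have "K \<subseteq> (\<Union>p\<in>K. ball p (d / 2))"
      using d(1) by auto
    then obtain D where D: "D \<subseteq> K" "finite D" "K \<subseteq> (\<Union>p\<in>D. ball p (d / 2))"
      using compactE_image[OF K(1), of K "\<lambda>p. ball p (d / 2)"] by auto
    \<comment> \<open>On the piece of \<open>K\<close> around \<open>p\<close>, both
      \<open>g\<close> and \<open>f\<close> stay within \<open>\<delta> / 2\<close> of the constant
      \<open>f p\<close>, hence within \<open>\<delta>\<close> of each other. Closed balls keep the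
      pieces compact.\<close>
    define T where "T p = {g \<in> C_space \<Omega>. g ` (K \<inter> cball p (d / 2)) \<subseteq> ball (f p) (\<delta> / 2)}" for p
    have "openin (compact_open_topology \<Omega>) (T p)" for p
    proof -
      have "compact (K \<inter> cball p (d / 2))" "K \<inter> cball p (d / 2) \<subseteq> \<Omega>" "open (ball (f p) (\<delta> / 2))"
        using K by (auto intro: compact_Int_closed)
      then show ?thesis
        unfolding compact_open_topology_def T_def
        by (intro topology_generated_by_Basis CollectI exI conjI) (rule refl)
    qed
    \<comment> \<open>The factor \<open>C_space \<Omega>\<close> matters for empty \<open>D\<close>,
      where the intersection of the \<open>T p\<close> is \<open>UNIV\<close>.\<close>
    then have "openin (compact_open_topology \<Omega>) ((\<Inter>p\<in>D. T p) \<inter> C_space \<Omega>)"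
      using D(2) openin_INT[of D "compact_open_topology \<Omega>" T] by simp
    moreover have "f \<in> T p" if "p \<in> D" for p
    proof -
      have "dist (f p) (f x) < \<delta> / 2" if "x \<in> K" "dist p x \<le> d / 2" for x
        using d(1) d(2)[of x p] that D(1) \<open>p \<in> D\<close> by auto
      then show ?thesis
        using f by (auto simp: T_def)
    qed
    moreover have "(\<Inter>p\<in>D. T p) \<inter> C_space \<Omega> \<subseteq> ?near f K \<delta>"
    proof
      fix g assume g: "g \<in> (\<Inter>p\<in>D. T p) \<inter> C_space \<Omega>"
      have "\<bar>g x - f x\<bar> < \<delta>" if x: "x \<in> K" for x
      proof -
        obtain p where p: "p \<in> D" "dist p x < d / 2"
          using D(3) x by auto
        then have "g \<in> T p" "x \<in> K \<inter> cball p (d / 2)"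
          using g x by auto
        then have "g x \<in> ball (f p) (\<delta> / 2)"
          unfolding T_def by blast
        moreover have "dist (f p) (f x) < \<delta> / 2"
          using d(1) d(2)[of x p] p x D(1) by auto
        ultimately show ?thesis
          unfolding mem_ball dist_real_def by linarith
      qed
      then show "g \<in> ?near f K \<delta>"
        using g by simp
    qed
    ultimately show "\<exists>T. openin (compact_open_topology \<Omega>) T \<and> f \<in> T \<and> T \<subseteq> U"
      using f subset_trans[OF _ K(4)] by (intro exI[of _ "(\<Inter>p\<in>D. T p) \<inter> C_space \<Omega>"] conjI) auto
  qed
  have "U \<subseteq> C_space \<Omega>" if "openin (compact_open_topology \<Omega>) U"
    using openin_subset[OF that] by simp
  then show ?thesis
    using forward backward by blast
qed

section \<open>Functions with a small open cover form a dense open set\<close>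

lemma nowhere_dense_in_Diff:
  assumes "openin X U" and "\<And>V. openin X V \<Longrightarrow> V \<noteq> {} \<Longrightarrow> V \<inter> U \<noteq> {}"
  shows "nowhere_dense_in X (topspace X - U)"
proof -
  have "closedin X (topspace X - U)"
    using assms(1) by blast
  then have "X closure_of (topspace X - U) = topspace X - U"
    by (rule closure_of_closedin)
  moreover have "X interior_of (topspace X - U) = {}"
    using assms(2)[of "X interior_of (topspace X - U)"] interior_of_subset[of X "topspace X - U"]
    by auto
  ultimately show ?thesis
    unfolding nowhere_dense_in_def by auto
qed

text \<open>The graph over \<open>K\<close> is compact, so the open union of interiors contains a
  \<open>\<delta>\<close>-neighbourhood of it, and this contains the graph of every \<open>g\<close>
  that is \<open>\<delta>\<close>-close to \<open>f\<close> on \<open>K\<close>.\<close>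

lemma openin_small_open_cover_graph:
  fixes K \<Omega> :: "'a::euclidean_space set"
  assumes "compact K" "K \<subseteq> \<Omega>"
  shows "openin (compact_open_topology \<Omega>) {f \<in> C_space \<Omega>. small_open_cover \<epsilon> (graph_on K f)}"
  unfolding openin_compact_open_topology_iff
proof (intro conjI ballI)
  show "{f \<in> C_space \<Omega>. small_open_cover \<epsilon> (graph_on K f)} \<subseteq> C_space \<Omega>"
    by blast
  fix f assume f: "f \<in> {f \<in> C_space \<Omega>. small_open_cover \<epsilon> (graph_on K f)}"
  then obtain B :: "nat \<Rightarrow> ('a \<times> real) set" where
    B: "\<forall>n\<ge>1. is_compact_box (B n) \<and> measure lebesgue (B n) \<le> \<epsilon> ^ n"
    and cover: "graph_on K f \<subseteq> (\<Union>n\<in>{1..}. interior (B n))"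
    unfolding small_open_cover_def by blast
  have "continuous_on K (\<lambda>x. (x, f x))"
    using f assms(2) continuous_on_subset unfolding C_space_def
    by (intro continuous_intros) auto
  then have "compact ((\<lambda>x. (x, f x)) ` K)"
    using assms(1) by (rule compact_continuous_image)
  moreover have "(\<lambda>x. (x, f x)) ` K = graph_on K f"
    by (auto simp: graph_on_def)
  ultimately have "compact (graph_on K f)"
    by simp
  moreover have "open (\<Union>n\<in>{1..}. interior (B n))"
    by blast
  ultimately obtain \<delta> where \<delta>:
    "\<delta> > 0" "(\<Union>z\<in>graph_on K f. ball z \<delta>) \<subseteq> (\<Union>n\<in>{1..}. interior (B n))"
    using cover compact_subset_open_imp_ball_epsilon_subset by blast
  have "small_open_cover \<epsilon> (graph_on K g)" if "\<forall>x\<in>K. \<bar>g x - f x\<bar> < \<delta>" for g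
  proof -
    have "graph_on K g \<subseteq> (\<Union>z\<in>graph_on K f. ball z \<delta>)"
      using that by (fastforce simp: graph_on_def dist_Pair_Pair dist_real_def abs_minus_commute)
    then show ?thesis
      using \<delta>(2) B unfolding small_open_cover_def by blast
  qed
  then have "{g \<in> C_space \<Omega>. \<forall>x\<in>K. \<bar>g x - f x\<bar> < \<delta>}
      \<subseteq> {f \<in> C_space \<Omega>. small_open_cover \<epsilon> (graph_on K f)}"
    by blast
  with assms \<delta>(1)
  show "\<exists>L \<delta>. compact L \<and> L \<subseteq> \<Omega> \<and> \<delta> > 0 \<and> {g \<in> C_space \<Omega>. \<forall>x\<in>L. \<bar>g x - f x\<bar> < \<delta>}
      \<subseteq> {f \<in> C_space \<Omega>. small_open_cover \<epsilon> (graph_on K f)}"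
    by (intro exI conjI)
qed

lemma small_open_cover_graph_approx:
  fixes C \<Omega> :: "'a::euclidean_space set"
  assumes "0 < \<epsilon>" "\<epsilon> \<le> 1" "compact C" "C \<subseteq> \<Omega>" "g \<in> C_space \<Omega>" "\<delta> > 0"
  obtains f where "f \<in> C_space \<Omega>" "\<And>x. x \<in> C \<Longrightarrow> \<bar>f x - g x\<bar> < \<delta>"
    "small_open_cover \<epsilon> (graph_on C f)"
proof -
  have g: "continuous_on C g"
    using assms continuous_on_subset unfolding C_space_def by auto
  obtain r where r: "r > 0" "\<And>x. x \<in> C \<Longrightarrow> norm x \<le> r"
    using compact_imp_bounded[OF assms(3)] bounded_pos by blast
  obtain M where M: "M > 0" "\<And>x. x \<in> C \<Longrightarrow> norm (g x) \<le> M"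
    using compact_imp_bounded[OF compact_continuous_image[OF g assms(3)]] bounded_pos
    by (metis imageI)
  have "closedin (top_of_set UNIV) C"
    using compact_imp_closed[OF assms(3)] by simp
  \<comment> \<open>The extension is needed because \<open>\<phi>\<close> below may move points out
    of \<open>C\<close>; its global bound confines the new graph.\<close>
  from Tietze[OF g this, of M] M
  obtain G where G: "continuous_on UNIV G" "\<And>x. x \<in> C \<Longrightarrow> G x = g x" "\<And>x. norm (G x) \<le> M"
    by auto
  \<comment> \<open>The extra radius 1 leaves room for the displacement by
    \<open>\<phi>\<close>.\<close>
  have "uniformly_continuous_on (cball 0 (r + 1)) G"
    using G(1) continuous_on_subset by (intro compact_uniformly_continuous) auto
  then obtain d where d: "d > 0"
    "\<And>x y. x \<in> cball 0 (r + 1) \<Longrightarrow> y \<in> cball 0 (r + 1) \<Longrightarrow> dist y x < d \<Longrightarrow> dist (G y) (G x) < \<delta>"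
    using \<open>\<delta> > 0\<close> unfolding uniformly_continuous_on_def by metis
  \<comment> \<open>Moving every coordinate by at most \<open>h\<close> moves a point by at most
    \<open>DIM('a) * h = min 1 (d / 2)\<close>.\<close>
  define h where "h = min 1 (d / 2) / DIM('a)"
  have h: "h > 0" "DIM('a) * h \<le> 1" "DIM('a) * h < d"
    using d(1) by (auto simp: h_def)
  obtain P Q :: "real set" where "finite P" "finite Q" and step:
    "\<And>\<eta>. \<eta> > 0 \<Longrightarrow> \<exists>s. continuous_on UNIV s \<and>
       (\<forall>t. \<bar>t\<bar> \<le> r \<longrightarrow> \<bar>s t - t\<bar> \<le> h \<and> (s t \<in> P \<or> (\<exists>q\<in>Q. \<bar>t - q\<bar> < \<eta>)))"
    using exists_continuous_step_function[OF h(1)] by metis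
  define grid :: "'a set" where
    "grid = (\<lambda>p. \<Sum>b\<in>Basis. p b *\<^sub>R b) ` (PiE Basis (\<lambda>_. P))"
  \<comment> \<open>The pair \<open>(e, v)\<close> stands for the plate around the hyperplane \<open>z \<bullet> e = v\<close>.\<close>
  define plates :: "(('a \<times> real) \<times> real) set" where
    "plates = (\<lambda>(b, q). ((b, 0), q)) ` (Basis \<times> Q) \<union> (\<lambda>p. ((0, 1), G p)) ` grid"
  have "finite grid"
    unfolding grid_def using \<open>finite P\<close> by (intro finite_imageI finite_PiE) auto
  then have "finite plates"
    unfolding plates_def using \<open>finite Q\<close> by auto
  moreover have "e \<in> Basis" if "(e, v) \<in> plates" for e :: "'a \<times> real" and v
    using that by (auto simp: plates_def Basis_prod_def)
  moreover have "max r M + 1 > 0"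
    using r by linarith
  ultimately obtain \<eta> where \<eta>: "\<eta> > 0" and plates:
    "\<And>X. (\<And>z i. z \<in> X \<Longrightarrow> i \<in> Basis \<Longrightarrow> \<bar>z \<bullet> i\<bar> < max r M + 1) \<Longrightarrow>
         (\<And>z. z \<in> X \<Longrightarrow> \<exists>(e, v)\<in>plates. \<bar>z \<bullet> e - v\<bar> < \<eta>) \<Longrightarrow> small_open_cover \<epsilon> X"
    using small_open_cover_plates[OF assms(1,2)] by metis
  \<comment> \<open>Only now is the staircase chosen: \<open>plates\<close> depends on
    \<open>P\<close>, \<open>Q\<close> and \<open>G\<close>, and \<open>\<eta>\<close> on
    \<open>plates\<close>.\<close>
  obtain s where s: "continuous_on UNIV s"
    "\<And>t. \<bar>t\<bar> \<le> r \<Longrightarrow> \<bar>s t - t\<bar> \<le> h"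
    "\<And>t. \<bar>t\<bar> \<le> r \<Longrightarrow> s t \<in> P \<or> (\<exists>q\<in>Q. \<bar>t - q\<bar> < \<eta>)"
    using step[OF \<eta>] by blast
  define \<phi> :: "'a \<Rightarrow> 'a" where "\<phi> x = (\<Sum>b\<in>Basis. s (x \<bullet> b) *\<^sub>R b)" for x
  have coord: "\<bar>x \<bullet> b\<bar> \<le> r" if "x \<in> C" "b \<in> Basis" for x b
    using Basis_le_norm[OF that(2)] r(2)[OF that(1)] order_trans by blast
  have "continuous_on UNIV \<phi>"
    unfolding \<phi>_def by (intro continuous_intros continuous_on_compose2[OF s(1)]) auto
  then have G\<phi>: "continuous_on UNIV (\<lambda>x. G (\<phi> x))"
    by (intro continuous_on_compose2[OF G(1)]) auto
  have close: "dist (\<phi> x) x \<le> DIM('a) * h" if "x \<in> C" for x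
  proof -
    have "dist (\<phi> x) x \<le> (\<Sum>b\<in>Basis. \<bar>(\<phi> x - x) \<bullet> b\<bar>)"
      unfolding dist_norm by (rule norm_le_l1)
    also have "\<dots> \<le> (\<Sum>b\<in>(Basis :: 'a set). h)"
      by (rule sum_mono) (use coord[OF that] s(2) in \<open>auto simp: \<phi>_def inner_diff_left inner_sum_left_Basis\<close>)
    finally show ?thesis by simp
  qed
  define f where "f = restrict (\<lambda>x. G (\<phi> x)) \<Omega>"
  have f_eq: "f x = G (\<phi> x)" if "x \<in> C" for x
    using that assms by (auto simp: f_def)
  show thesis
  proof
    have "continuous_on \<Omega> f \<longleftrightarrow> continuous_on \<Omega> (\<lambda>x. G (\<phi> x))"
      by (intro continuous_on_cong) (auto simp: f_def)
    then show "f \<in> C_space \<Omega>"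
      using G\<phi> continuous_on_subset by (auto simp: C_space_def f_def)
    show "\<bar>f x - g x\<bar> < \<delta>" if x: "x \<in> C" for x
    proof -
      have "norm (\<phi> x) \<le> norm x + dist (\<phi> x) x"
        unfolding dist_norm by norm
      then have "norm (\<phi> x) \<le> r + 1"
        using close[OF x] r(2)[OF x] h by linarith
      then have "dist (G (\<phi> x)) (G x) < \<delta>"
        using d(2)[of x "\<phi> x"] close[OF x] r(2)[OF x] h by auto
      then show ?thesis
        using x by (simp add: f_eq G(2) dist_real_def)
    qed
    show "small_open_cover \<epsilon> (graph_on C f)"
    proof (rule plates)
      fix z i assume "z \<in> graph_on C f" and i: "i \<in> (Basis :: ('a \<times> real) set)"
      then obtain x where x: "x \<in> C" "z = (x, f x)"
        by (auto simp: graph_on_def)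
      show "\<bar>z \<bullet> i\<bar> < max r M + 1"
        using i coord[OF x(1)] G(3)[of "\<phi> x"] by (fastforce simp: x f_eq Basis_prod_def)
    next
      fix z assume "z \<in> graph_on C f"
      then obtain x where x: "x \<in> C" "z = (x, f x)"
        by (auto simp: graph_on_def)
      show "\<exists>(e, v)\<in>plates. \<bar>z \<bullet> e - v\<bar> < \<eta>"
      \<comment> \<open>Near \<open>Q\<close> in some coordinate, the point lies in a plate
        orthogonal to an axis of the domain. Otherwise \<open>\<phi> x\<close> is a grid point, and
        \<open>f x\<close> is exactly one of the finitely many values of \<open>G\<close> on the
        grid.\<close>
      proof (cases "\<exists>b\<in>Basis. \<exists>q\<in>Q. \<bar>x \<bullet> b - q\<bar> < \<eta>")
        case True
        then obtain b q where "b \<in> Basis" "q \<in> Q" "\<bar>x \<bullet> b - q\<bar> < \<eta>"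
          by blast
        then show ?thesis
          by (intro bexI[of _ "((b, 0), q)"]) (auto simp: plates_def x)
      next
        case False
        then have "\<forall>b\<in>Basis. s (x \<bullet> b) \<in> P"
          using s(3) coord[OF x(1)] by blast
        then have "\<phi> x \<in> grid"
          unfolding grid_def \<phi>_def
          by (intro image_eqI[of _ _ "restrict (\<lambda>b. s (x \<bullet> b)) Basis"]) auto
        then show ?thesis
          using \<eta> by (intro bexI[of _ "((0, 1), G (\<phi> x))"]) (auto simp: plates_def x f_eq)
      qed
    qed
  qed
qed

lemma nowhere_dense_small_open_cover_graph:
  fixes K \<Omega> :: "'a::euclidean_space set"
  assumes "0 < \<epsilon>" "\<epsilon> \<le> 1" "compact K" "K \<subseteq> \<Omega>"
  shows "nowhere_dense_in (compact_open_topology \<Omega>)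
    (C_space \<Omega> - {f \<in> C_space \<Omega>. small_open_cover \<epsilon> (graph_on K f)})"
proof -
  let ?U = "{f \<in> C_space \<Omega>. small_open_cover \<epsilon> (graph_on K f)}"
  have "V \<inter> ?U \<noteq> {}" if V: "openin (compact_open_topology \<Omega>) V" "V \<noteq> {}" for V
  proof -
    obtain g where g: "g \<in> V" "g \<in> C_space \<Omega>"
      using V openin_subset by fastforce
    then obtain L \<delta> where L: "compact L" "L \<subseteq> \<Omega>" "\<delta> > 0"
      "{f \<in> C_space \<Omega>. \<forall>x\<in>L. \<bar>f x - g x\<bar> < \<delta>} \<subseteq> V"
      using V(1) unfolding openin_compact_open_topology_iff by blast
    \<comment> \<open>Closeness on \<open>L\<close> puts \<open>f\<close> into \<open>V\<close>,
      while the cover is wanted over \<open>K\<close>; the union serves both.\<close>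
    obtain f where f: "f \<in> C_space \<Omega>" "\<And>x. x \<in> K \<union> L \<Longrightarrow> \<bar>f x - g x\<bar> < \<delta>"
      "small_open_cover \<epsilon> (graph_on (K \<union> L) f)"
      using small_open_cover_graph_approx[OF assms(1,2) compact_Un[OF assms(3) L(1)] _ g(2) L(3)]
        assms(4) L(2) by auto
    have "graph_on K f \<subseteq> graph_on (K \<union> L) f"
      by (auto simp: graph_on_def)
    then have "small_open_cover \<epsilon> (graph_on K f)"
      using f(3) small_open_cover_subset by blast
    then show ?thesis
      using f L(4) by auto
  qed
  then show ?thesis
    using nowhere_dense_in_Diff[OF openin_small_open_cover_graph[OF assms(3,4)]] by simp
qed

section \<open>Compact exhaustion and the typical graph\<close>

text \<open>A locally compact subset of a Euclidean space is the intersection of a closed and an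
  open set; a compact exhaustion of the open one is cut down by the closed one.\<close>

lemma locally_compact_increasing_compact_Union:
  fixes \<Omega> :: "'a::euclidean_space set"
  assumes "locally compact \<Omega>"
  obtains K :: "nat \<Rightarrow> 'a set" where "\<And>n. compact (K n)" "incseq K" "(\<Union>n. K n) = \<Omega>"
proof -
  obtain S V where "closed S" "open V" and \<Omega>: "\<Omega> = S \<inter> V"
    using assms unfolding locally_compact_closed_Int_open by blast
  obtain C where C: "\<And>n. compact (C n)" "\<And>n. C n \<subseteq> interior (C (Suc n))" "\<Union>(range C) = V"
    using open_Union_compact_subsets[OF \<open>open V\<close>] by metis
  show thesis
  proof
    show "compact (S \<inter> C n)" for n
      using \<open>closed S\<close> C(1) by (rule closed_Int_compact)
    show "incseq (\<lambda>n. S \<inter> C n)"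
      using C(2) interior_subset by (intro incseq_SucI) blast
    show "(\<Union>n. S \<inter> C n) = \<Omega>"
      using C(3) \<Omega> by blast
  qed
qed

lemma microscopic_if_small_open_covers:
  assumes "\<And>\<epsilon>. \<epsilon> > 0 \<Longrightarrow> \<exists>\<theta>. 0 \<le> \<theta> \<and> \<theta> \<le> \<epsilon> \<and> small_open_cover \<theta> X"
  shows "microscopic X"
  unfolding microscopic_def
proof (intro allI impI)
  fix \<epsilon> :: real assume "\<epsilon> > 0"
  then obtain \<theta> B where \<theta>: "0 \<le> \<theta>" "\<theta> \<le> \<epsilon>"
    and B: "\<forall>n\<ge>1. is_compact_box (B n) \<and> measure lebesgue (B n) \<le> \<theta> ^ n"
    and cover: "X \<subseteq> (\<Union>n\<in>{1..}. interior (B n))"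
    using assms unfolding small_open_cover_def by meson
  have "measure lebesgue (B n) \<le> \<epsilon> ^ n" if "n \<ge> 1" for n
    using B that power_mono[OF \<theta>(2,1)] order_trans by blast
  moreover have "X \<subseteq> (\<Union>n\<in>{1..}. B n)"
    using cover interior_subset by blast
  ultimately show "\<exists>B. (\<forall>n\<ge>1. is_compact_box (B n) \<and> measure lebesgue (B n) \<le> \<epsilon> ^ n) \<and>
      X \<subseteq> (\<Union>n\<in>{1..}. B n)"
    using B by blast
qed

theorem theorem7p8:
  fixes \<Omega> :: "(real ^ 'd) set"
  assumes "locally compact \<Omega>"
  shows "typically (compact_open_topology \<Omega>) (\<lambda>f. microscopic (graph_on \<Omega> f))"
proof -
  obtain K where K: "\<And>n. compact (K n)" "incseq K" and \<Omega>: "(\<Union>n. K n) = \<Omega>"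
    using locally_compact_increasing_compact_Union[OF assms] by metis
  \<comment> \<open>A single index governs both the compact set and the tolerance. This suffices
    because \<open>K\<close> increases: each \<open>K j\<close> lies in all later
    \<open>K n\<close>, whose tolerances tend to 0.\<close>
  define U where "U n = {f \<in> C_space \<Omega>. small_open_cover (1 / Suc n) (graph_on (K n) f)}" for n
  have "nowhere_dense_in (compact_open_topology \<Omega>) (C_space \<Omega> - U n)" for n
    unfolding U_def using K(1) \<Omega> by (intro nowhere_dense_small_open_cover_graph) auto
  moreover have "C_space \<Omega> - (\<Inter>n. U n) = (\<Union>n. C_space \<Omega> - U n)"
    by blast
  ultimately have "comeager_in (compact_open_topology \<Omega>) (\<Inter>n. U n)"
    unfolding comeager_in_def meager_in_def
    by (auto simp: U_def intro!: exI[of _ "\<lambda>n. C_space \<Omega> - U n"])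
  moreover have "microscopic (graph_on \<Omega> f)" if f: "f \<in> (\<Inter>n. U n)" for f
  proof -
    have "microscopic (graph_on (K j) f)" for j
    proof (rule microscopic_if_small_open_covers)
      fix \<epsilon> :: real assume "\<epsilon> > 0"
      then obtain m where m: "1 / Suc m < \<epsilon>"
        using nat_approx_posE by blast
      define n where "n = max j m"
      have "1 / Suc n \<le> 1 / Suc m"
        by (intro divide_left_mono) (auto simp: n_def)
      moreover have "small_open_cover (1 / Suc n) (graph_on (K n) f)"
        using f by (auto simp: U_def)
      moreover have "graph_on (K j) f \<subseteq> graph_on (K n) f"
        using incseqD[OF K(2), of j n] by (auto simp: n_def graph_on_def)
      ultimately show "\<exists>\<theta>. 0 \<le> \<theta> \<and> \<theta> \<le> \<epsilon> \<and> small_open_cover \<theta> (graph_on (K j) f)"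
        using m by (intro exI[of _ "1 / Suc n"]) (auto intro: small_open_cover_subset)
    qed
    \<comment> \<open>Each \<open>U n\<close> controls the graph over a compact piece only; closure
      under countable unions yields the whole graph.\<close>
    then have "microscopic (\<Union>j. graph_on (K j) f)"
      by (rule microscopic_UN)
    moreover have "(\<Union>j. graph_on (K j) f) = graph_on \<Omega> f"
      using \<Omega> by (auto simp: graph_on_def)
    ultimately show ?thesis by simp
  qed
  ultimately show ?thesis
    unfolding typically_def by blast
qed

end
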